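(* If $(X,T)$ is an almost $\mathcal{F}$-diam-mean equicontinuous dynamical system, then $(\mathcal{M}(X),T)$ is almost $\mathcal{F}$-diam-mean equicontinuous.
   Context: A dynamical system $(X,T)$ is a compact metric space $(X,d)$ with a continuous surjection $T\colon X\to X$. $\mathcal{M}(X)$ is the set of Borel probability measures on $X$ with the Wasserstein metric $d(\mu_1,\mu_2)=\min_{\kappa}\int d\,\mathrm{d}\kappa$ (minimum over all couplings $\kappa$ of $\mu_1,\mu_2$), a compact metric space; $T\mu:=T_*\mu$ is the push forward, and $(\mathcal{M}(X),T)$ is a dynamical system. For any dynamical system $(X,T)$: $B_\delta(x)=\{x'\in X:d(x,x')\le\delta\}$; for non-empty closed $A\subseteq X$ the $\mathcal{F}$-mean diameter is $\operatorname{Diam}_{\mathcal{F}}(A)=\limsup_{n\to\infty}\frac1n\sum_{k=0}^{n-1}\operatorname{diam}(T^kA)$ (the letter $\mathcal{F}$ only indicates averaging over $\{0,\dots,n-1\}$). A point $x\in X$ is an $\mathcal{F}$-diam-mean equicontinuity point if for all $\epsilon>0$ there is $\delta>0$ with $\operatorname{Diam}_{\mathcal{F}}(B_\delta(x))<\epsilon$. $(X,T)$ is almost $\mathcal{F}$-diam-mean equicontinuous if the set of its $\mathcal{F}$-diam-mean equicontinuity points is dense in $X$. *)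

theory Defs
  imports "HOL-Probability.Probability"
begin

definition dynamical_system ::
    "'a set \<Rightarrow> ('a \<Rightarrow> 'a \<Rightarrow> real) \<Rightarrow> ('a \<Rightarrow> 'a) \<Rightarrow> bool" where
  "dynamical_system X d T \<longleftrightarrow>
     Metric_space X d \<and> compact_space (Metric_space.mtopology X d) \<and>
     continuous_map (Metric_space.mtopology X d) (Metric_space.mtopology X d) T \<and>
     T ` X = X"

text \<open>The library's \<^const>\<open>diameter\<close>, for an explicit metric instead of \<^const>\<open>dist\<close>.\<close>

definition diam :: "('a \<Rightarrow> 'a \<Rightarrow> real) \<Rightarrow> 'a set \<Rightarrow> real" where
  "diam d A = (if A = {} then 0 else SUP (x, y)\<in>A \<times> A. d x y)"

text \<open>The limit superior is taken in \<^typ>\<open>ereal\<close>, a complete lattice. The term for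
  \<open>n = 0\<close> is \<open>0\<close> and does not influence it.\<close>

definition mean_diam :: "('a \<Rightarrow> 'a \<Rightarrow> real) \<Rightarrow> ('a \<Rightarrow> 'a) \<Rightarrow> 'a set \<Rightarrow> ereal" where
  "mean_diam d T A =
     limsup (\<lambda>n. ereal (1 / real n * (\<Sum>k<n. diam d ((T ^^ k) ` A))))"

definition diam_mean_equicontinuity_point ::
    "'a set \<Rightarrow> ('a \<Rightarrow> 'a \<Rightarrow> real) \<Rightarrow> ('a \<Rightarrow> 'a) \<Rightarrow> 'a \<Rightarrow> bool" where
  "diam_mean_equicontinuity_point X d T x \<longleftrightarrow>
     x \<in> X \<and>
     (\<forall>\<epsilon>>0. \<exists>\<delta>>0. mean_diam d T (Metric_space.mcball X d x \<delta>) < ereal \<epsilon>)"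

definition almost_diam_mean_equicontinuous ::
    "'a set \<Rightarrow> ('a \<Rightarrow> 'a \<Rightarrow> real) \<Rightarrow> ('a \<Rightarrow> 'a) \<Rightarrow> bool" where
  "almost_diam_mean_equicontinuous X d T \<longleftrightarrow>
     Metric_space.mtopology X d closure_of {x. diam_mean_equicontinuity_point X d T x} = X"

text \<open>The library's \<^const>\<open>borel\<close> lives on all of a topological type; here the
  Borel sets of the carrier \<open>X\<close> are generated by the open sets of the metric \<open>d\<close>.\<close>

definition borel_on :: "'a set \<Rightarrow> ('a \<Rightarrow> 'a \<Rightarrow> real) \<Rightarrow> 'a measure" where
  "borel_on X d = sigma X {U. openin (Metric_space.mtopology X d) U}"

definition borel_prob_measures :: "'a set \<Rightarrow> ('a \<Rightarrow> 'a \<Rightarrow> real) \<Rightarrow> 'a measure set" where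
  "borel_prob_measures X d = {\<mu>. prob_space \<mu> \<and> sets \<mu> = sets (borel_on X d)}"

text \<open>On a compact (hence separable) metric space the product sigma-algebra used here
  is the Borel sigma-algebra of the product \<open>X \<times> X\<close>.\<close>

definition couplings ::
    "'a set \<Rightarrow> ('a \<Rightarrow> 'a \<Rightarrow> real) \<Rightarrow> 'a measure \<Rightarrow> 'a measure \<Rightarrow> ('a \<times> 'a) measure set" where
  "couplings X d \<mu> \<nu> =
     {\<kappa>. prob_space \<kappa> \<and> sets \<kappa> = sets (borel_on X d \<Otimes>\<^sub>M borel_on X d) \<and>
          distr \<kappa> (borel_on X d) fst = \<mu> \<and> distr \<kappa> (borel_on X d) snd = \<nu>}"

text \<open>On a compact space the infimum is attained, so it is the minimum over all couplings.
  The value \<open>0\<close> for arguments that are not Borel probability measures is a convention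
  only: \<^const>\<open>Metric_space\<close> requires nonnegativity and symmetry outside the carrier too.\<close>

definition wasserstein ::
    "'a set \<Rightarrow> ('a \<Rightarrow> 'a \<Rightarrow> real) \<Rightarrow> 'a measure \<Rightarrow> 'a measure \<Rightarrow> real" where
  "wasserstein X d \<mu> \<nu> =
     (if \<mu> \<in> borel_prob_measures X d \<and> \<nu> \<in> borel_prob_measures X d
      then INF \<kappa>\<in>couplings X d \<mu> \<nu>. \<integral>p. d (fst p) (snd p) \<partial>\<kappa>
      else 0)"

definition push_forward ::
    "'a set \<Rightarrow> ('a \<Rightarrow> 'a \<Rightarrow> real) \<Rightarrow> ('a \<Rightarrow> 'a) \<Rightarrow> 'a measure \<Rightarrow> 'a measure" where
  "push_forward X d T \<mu> = distr \<mu> (borel_on X d) T"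

end

theory Submission
  imports Defs
begin

text \<open>
  The equicontinuity points of \<open>(\<M>(X), T)\<close> that make up the dense set are the probability
  measures \<open>\<nu>\<close> concentrated on a finite set \<open>F\<close> of equicontinuity points of \<open>(X, T)\<close>
  (\<open>finitely_supported_approximation\<close>). Density is inherited from \<open>X\<close>: a dense set contains
  finite \<open>r\<close>-nets, and pushing \<open>\<mu>\<close> forward along a measurable map that sends each point to a net
  point within \<open>r\<close> moves \<open>\<mu>\<close> by at most \<open>r\<close>.

  Such a \<open>\<nu>\<close> is an equicontinuity point (\<open>finitely_supported_equicontinuity_point\<close>) for the
  following reason. Choose for each \<open>c \<in> F\<close> a ball around \<open>c\<close> of small mean diameter, and let
  \<open>m\<close> be a lower bound of the radii. If \<open>\<rho>\<close> is close to \<open>\<nu>\<close>, some coupling \<open>\<kappa>\<close> of \<open>\<nu>\<close> and \<open>\<rho>\<close>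
  has small cost, and \<open>\<kappa>\<close>-almost every pair \<open>(x, y)\<close> has \<open>x \<in> F\<close>. Either \<open>y\<close> is in the ball chosen
  around \<open>x\<close>, and then \<open>T\<^sup>k x\<close> and \<open>T\<^sup>k y\<close> are at most the diameter of its \<open>k\<close>-th image apart, or
  \<open>d x y \<ge> m\<close>, and then their distance is bounded by \<open>C d x y / m\<close> where \<open>C\<close> bounds \<open>d\<close>. So the
  distance is always at most the sum of both terms, the first one summed over all of \<open>F\<close>.
  Integrating against \<open>\<kappa>\<close> bounds the distance of \<open>T\<^sup>k \<nu>\<close> and \<open>T\<^sup>k \<rho>\<close> by the sum over \<open>c \<in> F\<close> of
  the diameters plus \<open>C/m\<close> times the cost of \<open>\<kappa>\<close>. The bound is uniform in \<open>\<rho>\<close>, and averaging over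
  \<open>k < n\<close> turns the diameters into the mean diameters that were chosen small.

  Passing from the distance to the centre to the diameter of the ball uses the triangle
  inequality for the Wasserstein distance. It is derived from an explicit gluing of couplings:
  gluing along a factor map with countably many values needs no disintegration
  (\<open>glue_along_countable_factor\<close>), and mapping the common marginal to a fine finite net changes the
  cost by an arbitrarily small amount.
\<close>

section \<open>Compact metric spaces and their Borel sets\<close>

locale compact_metric_space = Metric_space X d
  for X :: "'a set" and d :: "'a \<Rightarrow> 'a \<Rightarrow> real" +
  assumes compact: "compact_space mtopology"
begin

abbreviation "B \<equiv> borel_on X d"
abbreviation "P \<equiv> borel_prob_measures X d"
abbreviation "W \<equiv> wasserstein X d"

lemma sets_borel_on: "sets B = sigma_sets X {U. openin mtopology U}"
  and space_borel_on [simp]: "space B = X"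
proof -
  have "{U. openin mtopology U} \<subseteq> Pow X"
    using openin_mtopology by blast
  then show "sets B = sigma_sets X {U. openin mtopology U}" "space B = X"
    by (simp_all add: borel_on_def)
qed

lemma sets_open [measurable]: "openin mtopology U \<Longrightarrow> U \<in> sets B"
  by (simp add: sets_borel_on sigma_sets.Basic)

lemma measurable_dist_point [measurable]: "(\<lambda>x. d x c) \<in> borel_measurable B"
  if "c \<in> X" for c
proof (rule borel_measurable_iff_less[THEN iffD2], rule allI)
  fix a
  have "{x \<in> space B. d x c < a} = mball c a"
    using that by (auto simp: commute)
  then show "{x \<in> space B. d x c < a} \<in> sets B"
    by simp
qed

lemma measurable_continuous_map:
  assumes "continuous_map mtopology mtopology T"
  shows "T \<in> measurable B B"
  unfolding borel_on_def
proof (rule measurable_sigma_sets)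
  show "sets (sigma X {U. openin mtopology U}) = sigma_sets X {U. openin mtopology U}"
    using sets_borel_on by (simp add: borel_on_def)
  show "{U. openin mtopology U} \<subseteq> Pow X"
    using openin_mtopology by blast
  show "T \<in> space (sigma X {U. openin mtopology U}) \<rightarrow> X"
    using continuous_map_image_subset_topspace[OF assms] space_borel_on
    by (auto simp: borel_on_def)
  fix U assume "U \<in> {U. openin mtopology U}"
  then have "openin mtopology {x \<in> X. T x \<in> U}"
    using openin_continuous_map_preimage[OF assms] by auto
  moreover have "T -` U \<inter> space (sigma X {U. openin mtopology U}) = {x \<in> X. T x \<in> U}"
    using space_borel_on by (auto simp: borel_on_def)
  ultimately show "T -` U \<inter> space (sigma X {U. openin mtopology U})
      \<in> sets (sigma X {U. openin mtopology U})"
    using sets_open by (simp add: borel_on_def)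
qed

lemma dist_bounded: obtains C where "0 \<le> C" "\<And>x y. x \<in> X \<Longrightarrow> y \<in> X \<Longrightarrow> d x y \<le> C"
proof -
  have "mbounded X"
    using compact compactin_imp_mbounded by (auto simp: compact_space_def)
  then show ?thesis
    using that unfolding mbounded_alt_pos by (meson less_imp_le)
qed

lemma finite_net_in_dense_set:
  assumes dense: "X \<subseteq> mtopology closure_of S" and "0 < e"
  obtains F where "finite F" "F \<subseteq> S" "F \<subseteq> X" "X \<subseteq> (\<Union>c\<in>F. mball c e)"
proof -
  have "topspace mtopology \<subseteq> \<Union>((\<lambda>c. mball c e) ` (S \<inter> X))"
    using assms unfolding metric_closure_of by (fastforce simp: commute)
  moreover have "\<forall>U\<in>(\<lambda>c. mball c e) ` (S \<inter> X). openin mtopology U"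
    by auto
  ultimately obtain \<F> where "finite \<F>" "\<F> \<subseteq> (\<lambda>c. mball c e) ` (S \<inter> X)" "X \<subseteq> \<Union>\<F>"
    using compact unfolding compact_space_alt topspace_mtopology by meson
  then obtain F where "finite F" "F \<subseteq> S \<inter> X" "\<F> = (\<lambda>c. mball c e) ` F"
    by (meson finite_subset_image)
  then show ?thesis
    using that \<open>X \<subseteq> \<Union>\<F>\<close> by auto
qed

lemma finite_valued_approximation:
  assumes dense: "X \<subseteq> mtopology closure_of S" and "0 < e"
  obtains F f where "finite F" "F \<subseteq> S" "F \<subseteq> X" "f \<in> measurable B (count_space F)"
    "\<And>x. x \<in> X \<Longrightarrow> d x (f x) < e"
proof -
  obtain F where F: "finite F" "F \<subseteq> S" "F \<subseteq> X" "X \<subseteq> (\<Union>c\<in>F. mball c e)"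
    using finite_net_in_dense_set[OF assms] .
  then obtain cs where cs: "set cs = F"
    using finite_list by blast
  define i where "i x = (LEAST i. i < length cs \<and> d x (cs ! i) < e)" for x
  have i: "i x < length cs \<and> d x (cs ! i x) < e" if "x \<in> X" for x
  proof -
    obtain c where "c \<in> F" "d x c < e"
      using subsetD[OF F(4) \<open>x \<in> X\<close>] by (auto simp: commute)
    then have "\<exists>j. j < length cs \<and> d x (cs ! j) < e"
      using cs by (metis in_set_conv_nth)
    then show ?thesis
      unfolding i_def by (rule LeastI_ex)
  qed
  have "Measurable.pred B (\<lambda>x. j < length cs \<and> d x (cs ! j) < e)" for j
  proof (cases "j < length cs")
    case True
    then have "cs ! j \<in> X"
      using cs F(3) nth_mem by blast
    then show ?thesis
      by measurable
  qed simp
  then have i_meas: "i \<in> measurable B (count_space UNIV)"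
    unfolding i_def by (rule measurable_Least)
  have "(\<lambda>x. cs ! i x) \<in> measurable B (count_space F)"
    unfolding measurable_count_space_eq2[OF F(1)]
  proof (intro conjI ballI)
    show "(\<lambda>x. cs ! i x) \<in> space B \<rightarrow> F"
      using i cs by auto
    fix a
    have "(\<lambda>x. cs ! i x) -` {a} \<inter> space B = i -` {j. cs ! j = a} \<inter> space B"
      by auto
    also have "\<dots> \<in> sets B"
      using i_meas by (rule measurable_sets) simp
    finally show "(\<lambda>x. cs ! i x) -` {a} \<inter> space B \<in> sets B" .
  qed
  moreover have "d x (cs ! i x) < e" if "x \<in> X" for x
    using i[OF that] by simp
  ultimately show ?thesis
    by (rule that[OF F(1-3)])
qed

text \<open>A compact metric space is separable, which is what makes \<open>d\<close> measurable for the
  product of the Borel sigma-algebras: \<open>d x y < a\<close> holds iff \<open>d x q + d q y < a\<close> for some \<open>q\<close>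
  in a countable dense set.\<close>

lemma measurable_dist [measurable]: "(\<lambda>p. d (fst p) (snd p)) \<in> borel_measurable (B \<Otimes>\<^sub>M B)"
proof -
  have dense: "X \<subseteq> mtopology closure_of X"
    using closure_of_topspace[of mtopology] by simp
  have "\<exists>F. finite F \<and> F \<subseteq> X \<and> X \<subseteq> (\<Union>c\<in>F. mball c (1 / real (Suc n)))" for n
    using finite_net_in_dense_set[OF dense, of "1 / real (Suc n)"] by (metis of_nat_0_less_iff zero_less_Suc zero_less_divide_1_iff)
  then obtain F where F: "\<And>n. finite (F n)" "\<And>n. F n \<subseteq> X"
      "\<And>n. X \<subseteq> (\<Union>c\<in>F n. mball c (1 / real (Suc n)))"
    by metis
  define Q where "Q = (\<Union>n. F n)"
  have Q: "countable Q" "Q \<subseteq> X"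
    unfolding Q_def using F by (auto intro: countable_finite)
  have near: "\<exists>q\<in>Q. d x q < e" if x: "x \<in> X" and "0 < e" for x e
  proof -
    obtain n where n: "1 / real (Suc n) < e"
      using nat_approx_posE[OF \<open>0 < e\<close>] .
    obtain c where "c \<in> F n" "d c x < 1 / real (Suc n)"
      using F(3)[of n] x by auto
    then show ?thesis
      using n unfolding Q_def by (intro bexI[of _ c]) (auto simp: commute)
  qed
  show ?thesis
  proof (rule borel_measurable_iff_less[THEN iffD2], rule allI)
    fix a
    have "{p \<in> space (B \<Otimes>\<^sub>M B). d (fst p) (snd p) < a}
        = {p \<in> space (B \<Otimes>\<^sub>M B). \<exists>q\<in>Q. d (fst p) q + d (snd p) q < a}"
    proof (intro Collect_cong conj_cong refl iffI)
      fix p assume p: "p \<in> space (B \<Otimes>\<^sub>M B)"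
      then have xy: "fst p \<in> X" "snd p \<in> X"
        by (auto simp: space_pair_measure)
      {
        assume less: "d (fst p) (snd p) < a"
        obtain q where q: "q \<in> Q" "d (fst p) q < (a - d (fst p) (snd p)) / 2"
          using near[OF xy(1), of "(a - d (fst p) (snd p)) / 2"] less by auto
        have "d (snd p) q \<le> d (snd p) (fst p) + d (fst p) q"
          using triangle xy q(1) Q(2) by blast
        then have "d (fst p) q + d (snd p) q < a"
          using q(2) less commute[of "snd p" "fst p"] by (simp add: field_simps)
        then show "\<exists>q\<in>Q. d (fst p) q + d (snd p) q < a"
          using q(1) by blast
      next
        assume "\<exists>q\<in>Q. d (fst p) q + d (snd p) q < a"
        then obtain q where q: "q \<in> Q" "d (fst p) q + d (snd p) q < a"
          by blast
        have "d (fst p) (snd p) \<le> d (fst p) q + d q (snd p)"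
          using triangle xy q(1) Q(2) by blast
        then show "d (fst p) (snd p) < a"
          using q(2) commute[of q "snd p"] by simp
      }
    qed
    also have "\<dots> \<in> sets (B \<Otimes>\<^sub>M B)"
    proof -
      have "Measurable.pred (B \<Otimes>\<^sub>M B) (\<lambda>p. d (fst p) q + d (snd p) q < a)" if "q \<in> Q" for q
      proof -
        have "q \<in> X"
          using that Q(2) by blast
        note measurable_dist_point[OF this, measurable]
        show ?thesis
          by measurable
      qed
      then have "Measurable.pred (B \<Otimes>\<^sub>M B) (\<lambda>p. \<exists>q\<in>Q. d (fst p) q + d (snd p) q < a)"
        using Q(1) by measurable
      then show ?thesis
        by (simp add: pred_def)
    qed
    finally show "{p \<in> space (B \<Otimes>\<^sub>M B). d (fst p) (snd p) < a} \<in> sets (B \<Otimes>\<^sub>M B)" .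
  qed
qed

end

section \<open>Gluing two probability spaces along a countable factor\<close>

text \<open>This is a fibre product. Let \<open>q c\<close> be the common mass of the fibres over \<open>c\<close>. The product
  measure, restricted to \<open>g x = h y\<close> and reweighted by \<open>1 / q (g x)\<close>, puts on each pair of fibres
  the product of their conditional distributions with total mass \<open>q c\<close>. Hence integrating out
  one variable leaves density \<open>1\<close> in the other, outside the null set of fibres of mass \<open>0\<close>.\<close>

lemma glue_along_countable_factor:
  assumes "prob_space M" "prob_space N" and F: "countable F"
    and g [measurable]: "g \<in> measurable M (count_space F)"
    and h [measurable]: "h \<in> measurable N (count_space F)"
    and same_law: "distr M (count_space F) g = distr N (count_space F) h"
  obtains \<pi> where "prob_space \<pi>" "sets \<pi> = sets (M \<Otimes>\<^sub>M N)"
    "distr \<pi> M fst = M" "distr \<pi> N snd = N" "AE p in \<pi>. g (fst p) = h (snd p)"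
proof -
  interpret M: prob_space M by fact
  interpret N: prob_space N by fact
  interpret MN: pair_prob_space M N ..
  define q where "q c = emeasure (distr M (count_space F) g) {c}" for c
  define w where "w p = indicator {p. g (fst p) = h (snd p)} p / q (g (fst p))" for p :: "'a \<times> 'b"
  define \<pi> where "\<pi> = density (M \<Otimes>\<^sub>M N) w"
  have qM: "q c = emeasure M {x \<in> space M. g x = c}"
    and qN: "q c = emeasure N {y \<in> space N. h y = c}" if "c \<in> F" for c
  proof -
    have "q c = emeasure M (g -` {c} \<inter> space M)"
      unfolding q_def using that by (subst emeasure_distr) auto
    then show "q c = emeasure M {x \<in> space M. g x = c}"
      by (simp add: vimage_def Int_def conj_commute)
    have "q c = emeasure N (h -` {c} \<inter> space N)"
      unfolding q_def same_law using that by (subst emeasure_distr) auto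
    then show "q c = emeasure N {y \<in> space N. h y = c}"
      by (simp add: vimage_def Int_def conj_commute)
  qed
  have q_finite: "q c \<noteq> \<infinity>" for c
    unfolding q_def
    by (metis M.prob_space_distr g finite_measure.emeasure_finite infinity_ennreal_def prob_space.finite_measure)
  have gF: "g x \<in> F" if "x \<in> space M" for x
    using measurable_space[OF g that] by simp
  have hF: "h y \<in> F" if "y \<in> space N" for y
    using measurable_space[OF h that] by simp
  have [measurable]: "{p \<in> space (M \<Otimes>\<^sub>M N). g (fst p) = h (snd p)} \<in> sets (M \<Otimes>\<^sub>M N)"
  proof -
    have "(\<lambda>p. (g (fst p), h (snd p))) \<in> measurable (M \<Otimes>\<^sub>M N) (count_space (F \<times> F))"
      unfolding pair_measure_countable[OF F F, symmetric] by measurable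
    from measurable_sets[OF this, of "{(c, c) | c. c \<in> F}"]
    have "(\<lambda>p. (g (fst p), h (snd p))) -` {(c, c) | c. c \<in> F} \<inter> space (M \<Otimes>\<^sub>M N) \<in> sets (M \<Otimes>\<^sub>M N)"
      by auto
    also have "(\<lambda>p. (g (fst p), h (snd p))) -` {(c, c) | c. c \<in> F} \<inter> space (M \<Otimes>\<^sub>M N)
        = {p \<in> space (M \<Otimes>\<^sub>M N). g (fst p) = h (snd p)}"
      using hF by (auto simp: space_pair_measure)
    finally show ?thesis .
  qed
  have [measurable]: "q \<in> measurable (count_space F) borel"
    by simp
  have w_eq: "w p = indicator {p \<in> space (M \<Otimes>\<^sub>M N). g (fst p) = h (snd p)} p / q (g (fst p))"
    if "p \<in> space (M \<Otimes>\<^sub>M N)" for p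
    using that by (simp add: w_def indicator_def)
  have w [measurable]: "w \<in> borel_measurable (M \<Otimes>\<^sub>M N)"
    by (subst measurable_cong[OF w_eq]) measurable
  have w_g: "(\<integral>\<^sup>+y. w (x, y) \<partial>N) = 1" if "x \<in> space M" "q (g x) \<noteq> 0" for x
  proof -
    have "(\<integral>\<^sup>+y. w (x, y) \<partial>N) = (\<integral>\<^sup>+y. indicator {y \<in> space N. h y = g x} y / q (g x) \<partial>N)"
      by (rule nn_integral_cong) (auto simp: w_def indicator_def)
    also have "\<dots> = q (g x) / q (g x)"
      using gF[OF that(1)] by (subst nn_integral_divide) (auto simp: qN)
    finally show ?thesis
      using that q_finite by (simp add: ennreal_divide_self top.not_eq_extremum)
  qed
  have w_h: "(\<integral>\<^sup>+x. w (x, y) \<partial>M) = 1" if "y \<in> space N" "q (h y) \<noteq> 0" for y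
  proof -
    have "(\<integral>\<^sup>+x. w (x, y) \<partial>M) = (\<integral>\<^sup>+x. indicator {x \<in> space M. g x = h y} x / q (h y) \<partial>M)"
      by (rule nn_integral_cong) (auto simp: w_def indicator_def)
    also have "\<dots> = q (h y) / q (h y)"
      using hF[OF that(1)] by (subst nn_integral_divide) (auto simp: qM)
    finally show ?thesis
      using that q_finite by (simp add: ennreal_divide_self top.not_eq_extremum)
  qed
  have "AE x in M. q c = 0 \<longrightarrow> g x \<noteq> c" if "c \<in> F" for c
  proof (cases "q c = 0")
    case True
    then have "{x \<in> space M. g x = c} \<in> null_sets M"
      using that by (simp add: qM null_sets_def)
    then show ?thesis
      by (rule AE_I') auto
  qed simp
  then have "AE x in M. \<forall>c\<in>F. q c = 0 \<longrightarrow> g x \<noteq> c"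
    by (rule AE_ball_countable'[OF _ F])
  then have AE_g: "AE x in M. q (g x) \<noteq> 0"
    using AE_space by eventually_elim (use gF in auto)
  have "AE y in N. q c = 0 \<longrightarrow> h y \<noteq> c" if "c \<in> F" for c
  proof (cases "q c = 0")
    case True
    then have "{y \<in> space N. h y = c} \<in> null_sets N"
      using that by (simp add: qN null_sets_def)
    then show ?thesis
      by (rule AE_I') auto
  qed simp
  then have "AE y in N. \<forall>c\<in>F. q c = 0 \<longrightarrow> h y \<noteq> c"
    by (rule AE_ball_countable'[OF _ F])
  then have AE_h: "AE y in N. q (h y) \<noteq> 0"
    using AE_space by eventually_elim (use hF in auto)
  have sets_\<pi>: "sets \<pi> = sets (M \<Otimes>\<^sub>M N)"
    by (simp add: \<pi>_def)
  note [measurable_cong] = sets_\<pi>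
  have fst_\<pi>: "distr \<pi> M fst = M"
  proof (rule measure_eqI)
    fix A assume "A \<in> sets (distr \<pi> M fst)"
    then have A [measurable]: "A \<in> sets M" by simp
    have "emeasure (distr \<pi> M fst) A = emeasure \<pi> (fst -` A \<inter> space (M \<Otimes>\<^sub>M N))"
      by (subst emeasure_distr) (auto simp: \<pi>_def)
    also have "\<dots> = (\<integral>\<^sup>+p. w p * indicator (fst -` A \<inter> space (M \<Otimes>\<^sub>M N)) p \<partial>(M \<Otimes>\<^sub>M N))"
      unfolding \<pi>_def by (rule emeasure_density) measurable
    also have "\<dots> = (\<integral>\<^sup>+p. w p * indicator A (fst p) \<partial>(M \<Otimes>\<^sub>M N))"
      by (rule nn_integral_cong) (auto simp: indicator_def)
    also have "\<dots> = (\<integral>\<^sup>+x. \<integral>\<^sup>+y. w (x, y) * indicator A x \<partial>N \<partial>M)"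
      by (subst N.nn_integral_fst[symmetric]) auto
    also have "\<dots> = (\<integral>\<^sup>+x. (\<integral>\<^sup>+y. w (x, y) \<partial>N) * indicator A x \<partial>M)"
      by (intro nn_integral_cong nn_integral_multc) measurable
    also have "\<dots> = (\<integral>\<^sup>+x. indicator A x \<partial>M)"
      by (rule nn_integral_cong_AE) (use AE_g AE_space in eventually_elim, simp add: w_g)
    finally show "emeasure (distr \<pi> M fst) A = emeasure M A"
      by simp
  qed simp
  have snd_\<pi>: "distr \<pi> N snd = N"
  proof (rule measure_eqI)
    fix A assume "A \<in> sets (distr \<pi> N snd)"
    then have A [measurable]: "A \<in> sets N" by simp
    have "emeasure (distr \<pi> N snd) A = emeasure \<pi> (snd -` A \<inter> space (M \<Otimes>\<^sub>M N))"
      by (subst emeasure_distr) (auto simp: \<pi>_def)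
    also have "\<dots> = (\<integral>\<^sup>+p. w p * indicator (snd -` A \<inter> space (M \<Otimes>\<^sub>M N)) p \<partial>(M \<Otimes>\<^sub>M N))"
      unfolding \<pi>_def by (rule emeasure_density) measurable
    also have "\<dots> = (\<integral>\<^sup>+p. w p * indicator A (snd p) \<partial>(M \<Otimes>\<^sub>M N))"
      by (rule nn_integral_cong) (auto simp: indicator_def)
    also have "\<dots> = (\<integral>\<^sup>+y. \<integral>\<^sup>+x. w (x, y) * indicator A y \<partial>M \<partial>N)"
      by (subst MN.nn_integral_snd[symmetric]) auto
    also have "\<dots> = (\<integral>\<^sup>+y. (\<integral>\<^sup>+x. w (x, y) \<partial>M) * indicator A y \<partial>N)"
      by (intro nn_integral_cong nn_integral_multc) measurable
    also have "\<dots> = (\<integral>\<^sup>+y. indicator A y \<partial>N)"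
      by (rule nn_integral_cong_AE) (use AE_h AE_space in eventually_elim, simp add: w_h)
    finally show "emeasure (distr \<pi> N snd) A = emeasure N A"
      by simp
  qed simp
  have "prob_space \<pi>"
    by (rule prob_space_distrD[of fst \<pi> M]) (auto simp: fst_\<pi> \<open>prob_space M\<close>)
  moreover have "AE p in \<pi>. g (fst p) = h (snd p)"
    unfolding \<pi>_def by (subst AE_density) (auto simp: w_def indicator_def)
  ultimately show ?thesis
    using that sets_\<pi> fst_\<pi> snd_\<pi> by blast
qed

section \<open>The Wasserstein distance is a metric\<close>

context compact_metric_space
begin

lemma borel_prob_measures_iff: "\<mu> \<in> P \<longleftrightarrow> prob_space \<mu> \<and> sets \<mu> = sets B"
  by (simp add: borel_prob_measures_def)

lemma distr_in_P: "distr M B f \<in> P" if "prob_space M" "f \<in> measurable M B"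
  using that by (simp add: borel_prob_measures_iff prob_space.prob_space_distr)

lemma distr_id_P: "distr \<mu> B (\<lambda>x. x) = \<mu>" if "\<mu> \<in> P"
  using that by (intro distr_id2) (simp add: borel_prob_measures_iff)

lemma measurable_dist_compose [measurable (raw)]:
  assumes [measurable]: "f \<in> measurable M B" "g \<in> measurable M B"
  shows "(\<lambda>p. d (f p) (g p)) \<in> borel_measurable M"
  using measurable_compose[OF measurable_Pair[OF assms] measurable_dist] by simp

lemma integrable_dist:
  assumes "prob_space M" and f [measurable]: "f \<in> measurable M B"
    and g [measurable]: "g \<in> measurable M B"
  shows "integrable M (\<lambda>p. d (f p) (g p))"
proof -
  interpret prob_space M by fact
  obtain C where "\<And>x y. x \<in> X \<Longrightarrow> y \<in> X \<Longrightarrow> d x y \<le> C"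
    using dist_bounded by blast
  then have "AE p in M. norm (d (f p) (g p)) \<le> C"
    using measurable_space[OF f] measurable_space[OF g] by (intro AE_I2) simp
  then show ?thesis
    by (rule integrable_const_bound) measurable
qed

text \<open>Every pair of \<open>X\<close>-valued random variables on one probability space is a coupling of
  their laws. All upper bounds on \<open>W\<close> come from here.\<close>

lemma wasserstein_le:
  assumes M: "prob_space M" and f [measurable]: "f \<in> measurable M B"
    and g [measurable]: "g \<in> measurable M B"
  shows "W (distr M B f) (distr M B g) \<le> (\<integral>p. d (f p) (g p) \<partial>M)"
proof -
  let ?\<kappa> = "distr M (B \<Otimes>\<^sub>M B) (\<lambda>p. (f p, g p))"
  have "distr ?\<kappa> B fst = distr M B f" "distr ?\<kappa> B snd = distr M B g"
    by (simp_all add: distr_distr comp_def)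
  then have "?\<kappa> \<in> couplings X d (distr M B f) (distr M B g)"
    using M by (simp add: couplings_def prob_space.prob_space_distr)
  moreover have "(\<integral>p. d (fst p) (snd p) \<partial>?\<kappa>) = (\<integral>p. d (f p) (g p) \<partial>M)"
    by (subst integral_distr) auto
  moreover have "bdd_below ((\<lambda>\<kappa>. \<integral>p. d (fst p) (snd p) \<partial>\<kappa>) ` K)" for K :: "('a \<times> 'a) measure set"
    by (rule bdd_belowI[of _ 0]) auto
  ultimately show ?thesis
    using distr_in_P[OF M f] distr_in_P[OF M g] unfolding wasserstein_def
    by (auto intro: cINF_lower2)
qed

lemma couplings_nonempty:
  assumes "\<mu> \<in> P" "\<nu> \<in> P"
  shows "couplings X d \<mu> \<nu> \<noteq> {}"
proof -
  have \<mu>: "prob_space \<mu>" "sets \<mu> = sets B" and \<nu>: "prob_space \<nu>" "sets \<nu> = sets B"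
    using assms by (auto simp: borel_prob_measures_iff)
  interpret \<mu>: prob_space \<mu> by fact
  interpret \<nu>: prob_space \<nu> by fact
  interpret pair_prob_space \<mu> \<nu> ..
  have "distr (\<mu> \<Otimes>\<^sub>M \<nu>) B fst = distr (\<mu> \<Otimes>\<^sub>M \<nu>) \<mu> fst"
    "distr (\<mu> \<Otimes>\<^sub>M \<nu>) B snd = distr (\<mu> \<Otimes>\<^sub>M \<nu>) \<nu> snd"
    using \<mu>(2) \<nu>(2) by (auto intro!: distr_cong)
  moreover have "distr (\<mu> \<Otimes>\<^sub>M \<nu>) \<mu> fst = \<mu>"
    by (rule \<nu>.distr_pair_fst)
  moreover have "distr (\<mu> \<Otimes>\<^sub>M \<nu>) \<nu> snd = \<nu>"
  proof (rule measure_eqI)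
    fix A assume A: "A \<in> sets (distr (\<mu> \<Otimes>\<^sub>M \<nu>) \<nu> snd)"
    have "snd -` A \<inter> space (\<mu> \<Otimes>\<^sub>M \<nu>) = space \<mu> \<times> A"
      using A sets.sets_into_space[of A \<nu>] by (auto simp: space_pair_measure)
    then show "emeasure (distr (\<mu> \<Otimes>\<^sub>M \<nu>) \<nu> snd) A = emeasure \<nu> A"
      using A by (simp add: emeasure_distr \<nu>.emeasure_pair_measure_Times \<mu>.emeasure_space_1)
  qed simp
  moreover have "sets (\<mu> \<Otimes>\<^sub>M \<nu>) = sets (B \<Otimes>\<^sub>M B)"
    using \<mu>(2) \<nu>(2) by (rule sets_pair_measure_cong)
  ultimately have "\<mu> \<Otimes>\<^sub>M \<nu> \<in> couplings X d \<mu> \<nu>"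
    by (simp add: couplings_def prob_space_axioms)
  then show ?thesis
    by blast
qed

lemma near_optimal_coupling:
  assumes "\<mu> \<in> P" "\<nu> \<in> P" "W \<mu> \<nu> < a"
  obtains \<kappa> where "prob_space \<kappa>" "sets \<kappa> = sets (B \<Otimes>\<^sub>M B)" "distr \<kappa> B fst = \<mu>"
    "distr \<kappa> B snd = \<nu>" "(\<integral>p. d (fst p) (snd p) \<partial>\<kappa>) < a"
proof -
  have "(INF \<kappa>\<in>couplings X d \<mu> \<nu>. \<integral>p. d (fst p) (snd p) \<partial>\<kappa>) < a"
    using assms by (simp add: wasserstein_def)
  then obtain \<kappa> where "\<kappa> \<in> couplings X d \<mu> \<nu>" "(\<integral>p. d (fst p) (snd p) \<partial>\<kappa>) < a"
    using cInf_lessD[of "(\<lambda>\<kappa>. \<integral>p. d (fst p) (snd p) \<partial>\<kappa>) ` couplings X d \<mu> \<nu>" a]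
      couplings_nonempty[OF assms(1,2)] by auto
  then show ?thesis
    using that by (auto simp: couplings_def)
qed

lemma wasserstein_nonneg: "0 \<le> W \<mu> \<nu>"
  using couplings_nonempty[of \<mu> \<nu>] by (auto simp: wasserstein_def intro!: cINF_greatest)

lemma wasserstein_sym_le: "W \<nu> \<mu> \<le> W \<mu> \<nu>"
proof (cases "\<mu> \<in> P \<and> \<nu> \<in> P")
  case True
  show ?thesis
  proof (rule dense_ge)
    fix a assume less: "W \<mu> \<nu> < a"
    obtain \<kappa> where \<kappa>: "prob_space \<kappa>" and [measurable_cong]: "sets \<kappa> = sets (B \<Otimes>\<^sub>M B)"
      and marginals: "distr \<kappa> B fst = \<mu>" "distr \<kappa> B snd = \<nu>"
      and cost: "(\<integral>p. d (fst p) (snd p) \<partial>\<kappa>) < a"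
      using True by (auto intro: near_optimal_coupling[OF _ _ less])
    have "W \<nu> \<mu> \<le> (\<integral>p. d (snd p) (fst p) \<partial>\<kappa>)"
      unfolding marginals[symmetric] by (intro wasserstein_le \<kappa>) measurable
    also have "\<dots> \<le> a"
      using cost by (simp add: commute)
    finally show "W \<nu> \<mu> \<le> a" .
  qed
qed (auto simp: wasserstein_def)

text \<open>Near-optimal couplings of \<open>\<mu>, \<nu>\<close> and of \<open>\<nu>, \<rho>\<close> are glued along \<open>f\<close> applied to the \<open>\<nu>\<close>-coordinate,
  where \<open>f\<close> has finitely many values and moves points by less than \<open>e/4\<close>. In the glued space the two
  \<open>\<nu>\<close>-coordinates \<open>y, y'\<close> need not agree, but \<open>f y = f y'\<close> puts them within \<open>e/2\<close> of each other.\<close>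

lemma wasserstein_triangle:
  assumes "\<mu> \<in> P" "\<nu> \<in> P" "\<rho> \<in> P"
  shows "W \<mu> \<rho> \<le> W \<mu> \<nu> + W \<nu> \<rho>"
proof (rule field_le_epsilon)
  fix e :: real assume "0 < e"
  then have less: "W \<mu> \<nu> < W \<mu> \<nu> + e/4" "W \<nu> \<rho> < W \<nu> \<rho> + e/4"
    by auto
  obtain \<kappa>1 where \<kappa>1: "prob_space \<kappa>1" and [measurable_cong]: "sets \<kappa>1 = sets (B \<Otimes>\<^sub>M B)"
    and marginals1: "distr \<kappa>1 B fst = \<mu>" "distr \<kappa>1 B snd = \<nu>"
    and cost1: "(\<integral>p. d (fst p) (snd p) \<partial>\<kappa>1) < W \<mu> \<nu> + e/4"
    by (rule near_optimal_coupling[OF assms(1,2) less(1)])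
  obtain \<kappa>2 where \<kappa>2: "prob_space \<kappa>2" and [measurable_cong]: "sets \<kappa>2 = sets (B \<Otimes>\<^sub>M B)"
    and marginals2: "distr \<kappa>2 B fst = \<nu>" "distr \<kappa>2 B snd = \<rho>"
    and cost2: "(\<integral>p. d (fst p) (snd p) \<partial>\<kappa>2) < W \<nu> \<rho> + e/4"
    by (rule near_optimal_coupling[OF assms(2,3) less(2)])
  have dense: "X \<subseteq> mtopology closure_of X"
    using closure_of_topspace[of mtopology] by simp
  obtain F f where "finite F" and f [measurable]: "f \<in> measurable B (count_space F)"
    and f_near: "\<And>x. x \<in> X \<Longrightarrow> d x (f x) < e/4" and "F \<subseteq> X"
    using finite_valued_approximation[OF dense, of "e/4"] \<open>0 < e\<close> by (metis zero_less_divide_iff zero_less_numeral)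
  have "distr \<kappa>1 (count_space F) (\<lambda>p. f (snd p)) = distr (distr \<kappa>1 B snd) (count_space F) f"
    by (simp add: distr_distr comp_def)
  also have "\<dots> = distr (distr \<kappa>2 B fst) (count_space F) f"
    by (simp add: marginals1 marginals2)
  also have "\<dots> = distr \<kappa>2 (count_space F) (\<lambda>p. f (fst p))"
    by (simp add: distr_distr comp_def)
  finally obtain \<pi> where \<pi>: "prob_space \<pi>" and [measurable_cong]: "sets \<pi> = sets (\<kappa>1 \<Otimes>\<^sub>M \<kappa>2)"
    and marginals: "distr \<pi> \<kappa>1 fst = \<kappa>1" "distr \<pi> \<kappa>2 snd = \<kappa>2"
    and same_cell: "AE p in \<pi>. f (snd (fst p)) = f (fst (snd p))"
    by (rule glue_along_countable_factor[OF \<kappa>1 \<kappa>2 countable_finite[OF \<open>finite F\<close>], rotated 2]) measurable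
  interpret \<pi>: prob_space \<pi> by fact
  have [measurable]: "(\<lambda>p. fst (fst p)) \<in> measurable \<pi> B" "(\<lambda>p. snd (fst p)) \<in> measurable \<pi> B"
    "(\<lambda>p. fst (snd p)) \<in> measurable \<pi> B" "(\<lambda>p. snd (snd p)) \<in> measurable \<pi> B"
    by measurable
  have int: "integrable \<pi> (\<lambda>p. d (fst (fst p)) (snd (fst p)))"
    "integrable \<pi> (\<lambda>p. d (fst (snd p)) (snd (snd p)))"
    "integrable \<pi> (\<lambda>p. d (fst (fst p)) (snd (snd p)))"
    by (intro integrable_dist[OF \<pi>]; measurable)+
  have "\<mu> = distr \<pi> B (\<lambda>p. fst (fst p))"
    unfolding marginals1[symmetric] by (subst marginals(1)[symmetric]) (simp add: distr_distr comp_def)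
  moreover have "\<rho> = distr \<pi> B (\<lambda>p. snd (snd p))"
    unfolding marginals2[symmetric] by (subst marginals(2)[symmetric]) (simp add: distr_distr comp_def)
  ultimately have "W \<mu> \<rho> \<le> (\<integral>p. d (fst (fst p)) (snd (snd p)) \<partial>\<pi>)"
    using wasserstein_le[OF \<pi>] by simp
  also have "\<dots> \<le> (\<integral>p. d (fst (fst p)) (snd (fst p)) + d (fst (snd p)) (snd (snd p)) + e/2 \<partial>\<pi>)"
  proof (rule integral_mono_AE)
    show "AE p in \<pi>. d (fst (fst p)) (snd (snd p))
        \<le> d (fst (fst p)) (snd (fst p)) + d (fst (snd p)) (snd (snd p)) + e/2"
      using same_cell AE_space
    proof eventually_elim
      case (elim p)
      obtain x y y' z where p: "p = ((x, y), (y', z))"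
        by (metis prod.collapse)
      have X: "x \<in> X" "y \<in> X" "y' \<in> X" "z \<in> X"
        using elim(2) sets_eq_imp_space_eq[OF \<open>sets \<pi> = _\<close>]
          sets_eq_imp_space_eq[OF \<open>sets \<kappa>1 = _\<close>] sets_eq_imp_space_eq[OF \<open>sets \<kappa>2 = _\<close>]
        by (auto simp: p space_pair_measure)
      have fX: "f y \<in> X" "f y' = f y"
        using elim(1) measurable_space[OF f, of y] X \<open>F \<subseteq> X\<close> by (auto simp: p)
      have "d y y' \<le> d y (f y) + d y' (f y')"
        using triangle[of y "f y" y'] X fX commute[of y' "f y"] by simp
      also have "\<dots> \<le> e/2"
        using f_near[of y] f_near[of y'] X by simp
      finally show ?case
        using triangle[of x y z] triangle[of y y' z] X by (simp add: p)
    qed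
  qed (use int in auto)
  also have "\<dots> = (\<integral>p. d (fst (fst p)) (snd (fst p)) \<partial>\<pi>) + (\<integral>p. d (fst (snd p)) (snd (snd p)) \<partial>\<pi>) + e/2"
    using int by (simp add: \<pi>.prob_space)
  also have "(\<integral>p. d (fst (fst p)) (snd (fst p)) \<partial>\<pi>) = (\<integral>p. d (fst p) (snd p) \<partial>\<kappa>1)"
    by (subst marginals(1)[symmetric], subst integral_distr) auto
  also have "(\<integral>p. d (fst (snd p)) (snd (snd p)) \<partial>\<pi>) = (\<integral>p. d (fst p) (snd p) \<partial>\<kappa>2)"
    by (subst marginals(2)[symmetric], subst integral_distr) auto
  finally show "W \<mu> \<rho> \<le> W \<mu> \<nu> + W \<nu> \<rho> + e"
    using cost1 cost2 by simp
qed

text \<open>Points of the erosion of \<open>U\<close> by \<open>\<delta>\<close> can leave \<open>U\<close> only by moving at least \<open>\<delta>\<close>. By Markov's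
  inequality couplings of vanishing cost give vanishing mass to such moves, so the erosion
  has \<open>\<mu>\<close>-measure at most \<open>\<nu> U\<close>, and the erosions exhaust \<open>U\<close> as \<open>\<delta>\<close> tends to \<open>0\<close>.\<close>

lemma measure_open_le_of_wasserstein_eq_0:
  assumes "\<mu> \<in> P" "\<nu> \<in> P" "W \<mu> \<nu> = 0" "openin mtopology U"
  shows "measure \<mu> U \<le> measure \<nu> U"
proof -
  interpret \<mu>: prob_space \<mu> using assms by (simp add: borel_prob_measures_iff)
  interpret \<nu>: prob_space \<nu> using assms by (simp add: borel_prob_measures_iff)
  have [measurable_cong]: "sets \<mu> = sets B" "sets \<nu> = sets B"
    using assms by (auto simp: borel_prob_measures_iff)
  have [measurable]: "U \<in> sets B" and "U \<subseteq> X"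
    using assms(4) openin_subset[OF assms(4)] by auto
  define E where "E \<delta> = X - (\<Union>c\<in>X - U. mball c \<delta>)" for \<delta>
  have E [measurable]: "E \<delta> \<in> sets B" for \<delta>
    unfolding E_def using sets_open[of X] by (intro sets.Diff sets_open) (auto intro: openin_topspace[of mtopology, simplified])
  have in_E: "x \<in> E \<delta> \<longleftrightarrow> x \<in> X \<and> (\<forall>c\<in>X - U. \<delta> \<le> d c x)" for x \<delta>
    by (auto simp: E_def not_less)
  have E_le: "measure \<mu> (E \<delta>) \<le> measure \<nu> U" if "0 < \<delta>" for \<delta>
  proof (rule field_le_epsilon)
    fix e :: real assume "0 < e"
    then have less: "W \<mu> \<nu> < \<delta> * e"
      using assms(3) that by simp
    obtain \<kappa> where \<kappa>: "prob_space \<kappa>" and sets_\<kappa> [measurable_cong]: "sets \<kappa> = sets (B \<Otimes>\<^sub>M B)"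
      and marginals: "distr \<kappa> B fst = \<mu>" "distr \<kappa> B snd = \<nu>"
      and cost: "(\<integral>p. d (fst p) (snd p) \<partial>\<kappa>) < \<delta> * e"
      by (rule near_optimal_coupling[OF assms(1,2) less])
    interpret \<kappa>: prob_space \<kappa> by fact
    have space_\<kappa>: "space \<kappa> = X \<times> X"
      using sets_eq_imp_space_eq[OF sets_\<kappa>] by (simp add: space_pair_measure)
    have [measurable]: "{p \<in> space \<kappa>. \<delta> \<le> d (fst p) (snd p)} \<in> sets \<kappa>"
      "fst -` E \<delta> \<inter> space \<kappa> \<in> sets \<kappa>" "snd -` U \<inter> space \<kappa> \<in> sets \<kappa>"
      by measurable
    have "measure \<mu> (E \<delta>) = measure \<kappa> (fst -` E \<delta> \<inter> space \<kappa>)"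
      unfolding marginals[symmetric] by (rule measure_distr) measurable
    also have "\<dots> \<le> measure \<kappa> ((snd -` U \<inter> space \<kappa>) \<union> {p \<in> space \<kappa>. \<delta> \<le> d (fst p) (snd p)})"
    proof (rule \<kappa>.finite_measure_mono)
      show "fst -` E \<delta> \<inter> space \<kappa> \<subseteq> (snd -` U \<inter> space \<kappa>) \<union> {p \<in> space \<kappa>. \<delta> \<le> d (fst p) (snd p)}"
        using in_E commute unfolding space_\<kappa> by fastforce
    qed measurable
    also have "\<dots> \<le> measure \<kappa> (snd -` U \<inter> space \<kappa>) + measure \<kappa> {p \<in> space \<kappa>. \<delta> \<le> d (fst p) (snd p)}"
      by (rule measure_Un_le) measurable
    finally have split: "measure \<mu> (E \<delta>)
        \<le> measure \<kappa> (snd -` U \<inter> space \<kappa>) + measure \<kappa> {p \<in> space \<kappa>. \<delta> \<le> d (fst p) (snd p)}" .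
    have U: "measure \<kappa> (snd -` U \<inter> space \<kappa>) = measure \<nu> U"
      unfolding marginals[symmetric] by (rule measure_distr[symmetric]) measurable
    have "measure \<kappa> {p \<in> space \<kappa>. \<delta> \<le> d (fst p) (snd p)} \<le> (\<integral>p. d (fst p) (snd p) \<partial>\<kappa>) / \<delta>"
    proof (rule integral_Markov_inequality_measure[where A = "{}"])
      show "integrable \<kappa> (\<lambda>p. d (fst p) (snd p))"
        by (rule integrable_dist[OF \<kappa>]) measurable
    qed (simp_all add: \<open>0 < \<delta>\<close>)
    also have "\<dots> \<le> e"
      using cost \<open>0 < \<delta>\<close> by (simp add: divide_le_eq mult.commute)
    finally show "measure \<mu> (E \<delta>) \<le> measure \<nu> U + e"
      using split U by linarith
  qed
  have Union_E: "(\<Union>n. E (1 / real (Suc n))) = U"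
  proof (intro equalityI subsetI)
    fix x assume "x \<in> (\<Union>n. E (1 / real (Suc n)))"
    then obtain n where x: "x \<in> X" "\<forall>c\<in>X - U. 1 / real (Suc n) \<le> d c x"
      using in_E by blast
    show "x \<in> U"
    proof (rule ccontr)
      assume "x \<notin> U"
      then have "1 / real (Suc n) \<le> d x x"
        using x by blast
      then show False
        using x(1) by simp
    qed
  next
    fix x assume "x \<in> U"
    then obtain r where r: "0 < r" "mball x r \<subseteq> U"
      using assms(4) openin_mtopology by blast
    obtain n where n: "1 / real (Suc n) < r"
      using nat_approx_posE[OF r(1)] .
    have "1 / real (Suc n) \<le> d c x" if c: "c \<in> X - U" for c
    proof (rule ccontr)
      assume "\<not> 1 / real (Suc n) \<le> d c x"
      then have "c \<in> mball x r"
        using n c \<open>x \<in> U\<close> \<open>U \<subseteq> X\<close> commute[of c x] by auto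
      then show False
        using r(2) c by blast
    qed
    then have "x \<in> E (1 / real (Suc n))"
      using in_E \<open>x \<in> U\<close> \<open>U \<subseteq> X\<close> by blast
    then show "x \<in> (\<Union>n. E (1 / real (Suc n)))"
      by blast
  qed
  have "incseq (\<lambda>n. E (1 / real (Suc n)))"
  proof (intro incseq_SucI subsetI)
    fix n x assume "x \<in> E (1 / real (Suc n))"
    then have x: "x \<in> X" "\<And>c. c \<in> X - U \<Longrightarrow> 1 / real (Suc n) \<le> d c x"
      unfolding in_E by auto
    have "1 / real (Suc (Suc n)) \<le> 1 / real (Suc n)"
      by (simp add: field_simps)
    then have "1 / real (Suc (Suc n)) \<le> d c x" if "c \<in> X - U" for c
      by (rule order_trans) (rule x(2)[OF that])
    then show "x \<in> E (1 / real (Suc (Suc n)))"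
      unfolding in_E using x(1) by blast
  qed
  moreover have "range (\<lambda>n. E (1 / real (Suc n))) \<subseteq> sets \<mu>"
    unfolding \<open>sets \<mu> = sets B\<close> by (rule image_subsetI) (rule E)
  ultimately have "(\<lambda>n. measure \<mu> (E (1 / real (Suc n)))) \<longlonglongrightarrow> measure \<mu> U"
    unfolding Union_E[symmetric] by (rule \<mu>.finite_Lim_measure_incseq[rotated])
  then show ?thesis
  proof (rule LIMSEQ_le_const2)
    show "\<exists>N. \<forall>n\<ge>N. measure \<mu> (E (1 / real (Suc n))) \<le> measure \<nu> U"
      by (intro exI allI impI E_le) simp
  qed
qed

lemma wasserstein_eq_0_imp_eq:
  assumes "\<mu> \<in> P" "\<nu> \<in> P" "W \<mu> \<nu> = 0"
  shows "\<mu> = \<nu>"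
proof (rule measure_eqI_generator_eq[where E = "{U. openin mtopology U}" and \<Omega> = X and A = "\<lambda>_. X"])
  interpret \<mu>: prob_space \<mu> using assms by (simp add: borel_prob_measures_iff)
  interpret \<nu>: prob_space \<nu> using assms by (simp add: borel_prob_measures_iff)
  have "W \<nu> \<mu> = 0"
    using assms(3) wasserstein_sym_le[of \<nu> \<mu>] wasserstein_nonneg[of \<nu> \<mu>] by simp
  then show "emeasure \<mu> U = emeasure \<nu> U" if "U \<in> {U. openin mtopology U}" for U
    using that measure_open_le_of_wasserstein_eq_0 assms
    by (simp add: \<mu>.emeasure_eq_measure \<nu>.emeasure_eq_measure order_antisym)
  show "emeasure \<mu> X \<noteq> \<infinity>" for i :: nat
    by simp
  show "Int_stable {U. openin mtopology U}"
    by (auto simp: Int_stable_def)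
  show "{U. openin mtopology U} \<subseteq> Pow X"
    using openin_mtopology by blast
qed (use assms openin_topspace[of mtopology] in \<open>auto simp: borel_prob_measures_iff sets_borel_on\<close>)

lemma wasserstein_metric: "Metric_space P W"
proof
  fix \<mu> \<nu>
  show "0 \<le> W \<mu> \<nu>"
    by (rule wasserstein_nonneg)
  show "W \<mu> \<nu> = W \<nu> \<mu>"
    by (intro order_antisym wasserstein_sym_le)
  assume P: "\<mu> \<in> P" "\<nu> \<in> P"
  have "W \<mu> \<mu> \<le> 0"
  proof -
    have "(\<lambda>x. x) \<in> measurable \<mu> B"
      using P by (intro measurable_ident_sets) (simp add: borel_prob_measures_iff)
    moreover have "space \<mu> = X"
      using P sets_eq_imp_space_eq[of \<mu> B] by (simp add: borel_prob_measures_iff)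
    then have "(\<integral>x. d x x \<partial>\<mu>) = 0"
      by (intro integral_eq_zero_AE AE_I2) simp
    ultimately show ?thesis
      using wasserstein_le[of \<mu> "\<lambda>x. x" "\<lambda>x. x"] P
      by (simp add: distr_id_P borel_prob_measures_iff)
  qed
  then show "W \<mu> \<nu> = 0 \<longleftrightarrow> \<mu> = \<nu>"
    using wasserstein_eq_0_imp_eq P wasserstein_nonneg by (metis order_antisym)
qed (rule wasserstein_triangle)

text \<open>Moving every point to a nearby point of a finite subset of \<open>S\<close> by a measurable map \<open>f\<close>
  transports \<open>\<mu>\<close> to \<open>f\<^sub>*\<mu>\<close> at cost at most \<open>r\<close>.\<close>

lemma finitely_supported_approximation:
  assumes dense: "X \<subseteq> mtopology closure_of S" and \<mu>: "\<mu> \<in> P" and "0 < r"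
  obtains F \<nu> where "finite F" "F \<subseteq> S" "\<nu> \<in> P" "AE x in \<nu>. x \<in> F" "W \<mu> \<nu> \<le> r"
proof -
  obtain F f where F: "finite F" "F \<subseteq> S" "F \<subseteq> X"
    and f: "f \<in> measurable B (count_space F)" and near: "\<And>x. x \<in> X \<Longrightarrow> d x (f x) < r"
    using finite_valued_approximation[OF dense \<open>0 < r\<close>] by metis
  have prob: "prob_space \<mu>" and [measurable_cong]: "sets \<mu> = sets B"
    using \<mu> by (auto simp: borel_prob_measures_iff)
  interpret \<mu>: prob_space \<mu> by fact
  have space_\<mu>: "space \<mu> = X"
    using sets_eq_imp_space_eq[OF \<open>sets \<mu> = sets B\<close>] by simp
  have "(\<lambda>c. c) \<in> measurable (count_space F) B"
    using F(3) by auto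
  from measurable_compose[OF f this] have fB [measurable]: "f \<in> measurable B B" .
  let ?\<nu> = "distr \<mu> B f"
  have \<nu>: "?\<nu> \<in> P"
    by (intro distr_in_P prob) measurable
  have F_sets: "F \<in> sets B"
  proof -
    have "{c} \<in> sets B" if "c \<in> F" for c
    proof -
      have "c \<in> X"
        using that F(3) by blast
      note measurable_dist_point[OF this, measurable]
      have "{x \<in> space B. d x c = 0} \<in> sets B"
        by measurable
      also have "{x \<in> space B. d x c = 0} = {c}"
        using \<open>c \<in> X\<close> by auto
      finally show ?thesis .
    qed
    then have "(\<Union>c\<in>F. {c}) \<in> sets B"
      using F(1) by (intro sets.finite_UN) auto
    then show ?thesis by simp
  qed
  have supp: "AE x in ?\<nu>. x \<in> F"
    using measurable_space[OF f] F_sets by (subst AE_distr_iff) (auto simp: space_\<mu>)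
  have "W \<mu> ?\<nu> \<le> r"
  proof -
    have "W \<mu> ?\<nu> = W (distr \<mu> B (\<lambda>x. x)) ?\<nu>"
      by (simp add: distr_id_P \<mu>)
    also have "\<dots> \<le> (\<integral>x. d x (f x) \<partial>\<mu>)"
      by (intro wasserstein_le prob) measurable
    also have "\<dots> \<le> (\<integral>x. r \<partial>\<mu>)"
      using near by (intro integral_mono integrable_dist prob) (auto simp: space_\<mu> less_imp_le)
    finally show ?thesis
      by (simp add: \<mu>.prob_space)
  qed
  then show ?thesis
    by (rule that[OF F(1,2) \<nu> supp])
qed

end

section \<open>Equicontinuity points of the induced system on measures\<close>

context compact_metric_space
begin

lemma dist_le_diam:
  assumes "A \<subseteq> X" "x \<in> A" "y \<in> A"
  shows "d x y \<le> diam d A"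
proof -
  obtain C where "\<And>x y. x \<in> X \<Longrightarrow> y \<in> X \<Longrightarrow> d x y \<le> C"
    using dist_bounded by blast
  then have "bdd_above ((\<lambda>(x, y). d x y) ` (A \<times> A))"
    using assms(1) by (intro bdd_aboveI[of _ C]) auto
  then have "(\<lambda>(x, y). d x y) (x, y) \<le> (SUP (x, y)\<in>A \<times> A. d x y)"
    using assms by (intro cSUP_upper) auto
  then show ?thesis
    using assms(2) by (auto simp: diam_def)
qed

lemma diam_nonneg:
  assumes "A \<subseteq> X"
  shows "0 \<le> diam d A"
proof (cases "A = {}")
  case False
  then obtain x where "x \<in> A"
    by blast
  then show ?thesis
    using dist_le_diam[OF assms, of x x] assms by auto
qed (simp add: diam_def)

lemma measurable_funpow: "T \<in> measurable B B \<Longrightarrow> T ^^ k \<in> measurable B B"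
  by (induction k) (auto intro: measurable_comp simp: id_def)

lemma push_forward_funpow:
  assumes T: "T \<in> measurable B B" and "\<mu> \<in> P"
  shows "(push_forward X d T ^^ k) \<mu> = distr \<mu> B (T ^^ k)"
proof (induction k)
  case 0
  then show ?case
    using distr_id_P[OF assms(2)] by (simp add: id_def)
next
  case (Suc k)
  have "T ^^ k \<in> measurable \<mu> B"
    using assms(2) measurable_funpow[OF T] by (simp add: borel_prob_measures_iff cong: measurable_cong_sets)
  then have "distr (distr \<mu> B (T ^^ k)) B T = distr \<mu> B (T \<circ> (T ^^ k))"
    by (rule distr_distr[OF T])
  then have "push_forward X d T ((push_forward X d T ^^ k) \<mu>) = distr \<mu> B (T \<circ> (T ^^ k))"
    unfolding Suc by (simp only: push_forward_def)
  then show ?case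
    by (simp add: comp_def)
qed

text \<open>A crude sum over \<open>F\<close>, not weighted by the masses of \<open>\<nu>\<close>, suffices because \<open>F\<close> is fixed before
  the radii: the mean diameters can be made small compared to \<open>1 / card F\<close>.\<close>

lemma finitely_supported_equicontinuity_point:
  assumes T: "T \<in> measurable B B" and \<nu>: "\<nu> \<in> P"
    and F: "finite F" "\<And>c. c \<in> F \<Longrightarrow> diam_mean_equicontinuity_point X d T c"
    and supp: "AE x in \<nu>. x \<in> F"
  shows "diam_mean_equicontinuity_point P W (push_forward X d T) \<nu>"
proof -
  interpret W: Metric_space P W
    by (rule wasserstein_metric)
  obtain C where C: "0 \<le> C" "\<And>x y. x \<in> X \<Longrightarrow> y \<in> X \<Longrightarrow> d x y \<le> C"
    using dist_bounded by blast
  have Tk_X: "(T ^^ k) x \<in> X" if "x \<in> X" for k x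
    using measurable_space[OF measurable_funpow[OF T]] that by simp
  have "\<exists>\<delta>>0. mean_diam W (push_forward X d T) (W.mcball \<nu> \<delta>) < ereal \<epsilon>" if "0 < \<epsilon>" for \<epsilon>
  proof -
    \<comment> \<open>With these constants both \<open>2 * card F * e\<close> and \<open>2 * C * \<eta>\<close> stay below \<open>\<epsilon> / 2\<close>. The factor \<open>2\<close>
      is the passage from radius to diameter, and adding \<open>1\<close> avoids division by \<open>0\<close>.\<close>
    define e where "e = \<epsilon> / (4 * (real (card F) + 1))"
    define \<eta> where "\<eta> = \<epsilon> / (4 * (C + 1))"
    have pos: "0 < e" "0 < \<eta>"
      using that C(1) by (auto simp: e_def \<eta>_def)
    have "\<forall>c\<in>F. \<exists>\<delta>>0. mean_diam d T (mcball c \<delta>) < ereal e"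
      using F(2) pos(1) unfolding diam_mean_equicontinuity_point_def by blast
    then obtain \<delta> where \<delta>: "\<And>c. c \<in> F \<Longrightarrow> 0 < \<delta> c"
      "\<And>c. c \<in> F \<Longrightarrow> mean_diam d T (mcball c (\<delta> c)) < ereal e"
      by metis
    define m where "m = Min (insert 1 (\<delta> ` F))"
    have m: "0 < m" "\<And>c. c \<in> F \<Longrightarrow> m \<le> \<delta> c"
      using F(1) \<delta>(1) by (auto simp: m_def)
    define D where "D k c = diam d ((T ^^ k) ` mcball c (\<delta> c))" for k c
    have sub: "(T ^^ k) ` mcball c r \<subseteq> X" for k c r
      using Tk_X by auto
    have D_nonneg: "0 \<le> D k c" for k c
      unfolding D_def by (rule diam_nonneg[OF sub])
    have pointwise: "d ((T ^^ k) x) ((T ^^ k) y) \<le> (\<Sum>c\<in>F. D k c) + C / m * d x y"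
      if "x \<in> F" "x \<in> X" "y \<in> X" for k x y
    proof (cases "d x y \<le> \<delta> x")
      case True
      then have "d ((T ^^ k) x) ((T ^^ k) y) \<le> D k x"
        unfolding D_def using that \<delta>(1)[of x] by (intro dist_le_diam sub imageI) auto
      also have "\<dots> \<le> (\<Sum>c\<in>F. D k c)"
        using F(1) that(1) D_nonneg by (intro member_le_sum) auto
      finally show ?thesis
        using C(1) m(1) by (simp add: add_increasing2)
    next
      case False
      then have "m \<le> d x y"
        using m(2)[OF that(1)] by simp
      then have "C \<le> C / m * d x y"
        using C(1) m(1) by (simp add: field_simps mult_left_mono)
      moreover have "d ((T ^^ k) x) ((T ^^ k) y) \<le> C"
        using C(2) Tk_X that by blast
      moreover have "0 \<le> (\<Sum>c\<in>F. D k c)"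
        using D_nonneg by (simp add: sum_nonneg)
      ultimately show ?thesis
        by linarith
    qed
    \<comment> \<open>The radius \<open>m * \<eta> / 2\<close> is strictly less than \<open>m * \<eta>\<close>, which leaves room for a coupling that is
      only nearly optimal.\<close>
    have near: "W (distr \<nu> B (T ^^ k)) (distr \<rho> B (T ^^ k)) \<le> (\<Sum>c\<in>F. D k c) + C * \<eta>"
      if "\<rho> \<in> W.mcball \<nu> (m * \<eta> / 2)" for \<rho> k
    proof -
      have "m * \<eta> / 2 < m * \<eta>"
        using m(1) pos(2) by simp
      moreover have "W \<nu> \<rho> \<le> m * \<eta> / 2" and "\<rho> \<in> P"
        using that by auto
      ultimately have less: "W \<nu> \<rho> < m * \<eta>"
        by linarith
      obtain \<kappa> where \<kappa>: "prob_space \<kappa>" and sets_\<kappa> [measurable_cong]: "sets \<kappa> = sets (B \<Otimes>\<^sub>M B)"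
        and marginals: "distr \<kappa> B fst = \<nu>" "distr \<kappa> B snd = \<rho>"
        and cost: "(\<integral>p. d (fst p) (snd p) \<partial>\<kappa>) < m * \<eta>"
        by (rule near_optimal_coupling[OF \<nu> \<open>\<rho> \<in> P\<close> less])
      interpret \<kappa>: prob_space \<kappa> by fact
      note [measurable] = measurable_funpow[OF T]
      have int: "integrable \<kappa> (\<lambda>p. d (fst p) (snd p))"
        by (intro integrable_dist \<kappa>) measurable
      have AE_F: "AE p in \<kappa>. fst p \<in> F"
        using supp unfolding marginals(1)[symmetric] by (rule AE_distrD[rotated]) measurable
      have space_\<kappa>: "space \<kappa> = X \<times> X"
        using sets_eq_imp_space_eq[OF sets_\<kappa>] by (simp add: space_pair_measure)
      have AE: "AE p in \<kappa>. d ((T ^^ k) (fst p)) ((T ^^ k) (snd p))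
          \<le> (\<Sum>c\<in>F. D k c) + C / m * d (fst p) (snd p)"
        using AE_F AE_space by eventually_elim (rule pointwise, auto simp: space_\<kappa>)
      have "W (distr \<nu> B (T ^^ k)) (distr \<rho> B (T ^^ k))
          = W (distr \<kappa> B (\<lambda>p. (T ^^ k) (fst p))) (distr \<kappa> B (\<lambda>p. (T ^^ k) (snd p)))"
        unfolding marginals[symmetric] by (simp add: distr_distr comp_def)
      also have "\<dots> \<le> (\<integral>p. d ((T ^^ k) (fst p)) ((T ^^ k) (snd p)) \<partial>\<kappa>)"
        by (intro wasserstein_le \<kappa>) measurable
      also have "\<dots> \<le> (\<integral>p. (\<Sum>c\<in>F. D k c) + C / m * d (fst p) (snd p) \<partial>\<kappa>)"
        using int by (intro integral_mono_AE AE integrable_dist \<kappa>) auto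
      also have "\<dots> = (\<Sum>c\<in>F. D k c) + C / m * (\<integral>p. d (fst p) (snd p) \<partial>\<kappa>)"
        using int by (simp add: \<kappa>.prob_space)
      finally have "W (distr \<nu> B (T ^^ k)) (distr \<rho> B (T ^^ k))
          \<le> (\<Sum>c\<in>F. D k c) + C / m * (\<integral>p. d (fst p) (snd p) \<partial>\<kappa>)" .
      moreover have "C / m * (\<integral>p. d (fst p) (snd p) \<partial>\<kappa>) \<le> C / m * (m * \<eta>)"
        using cost C(1) m(1) by (intro mult_left_mono) auto
      ultimately show ?thesis
        using m(1) by simp
    qed
    let ?A = "W.mcball \<nu> (m * \<eta> / 2)"
    have diam_le: "diam W ((push_forward X d T ^^ k) ` ?A) \<le> 2 * (\<Sum>c\<in>F. D k c) + 2 * C * \<eta>" for k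
    proof (cases "?A = {}")
      case True
      then show ?thesis
        using D_nonneg C(1) pos(2) by (simp add: diam_def sum_nonneg)
    next
      case False
      have P_k: "(push_forward X d T ^^ k) \<rho> = distr \<rho> B (T ^^ k)" "distr \<rho> B (T ^^ k) \<in> P"
        if "\<rho> \<in> P" for \<rho>
      proof -
        show "(push_forward X d T ^^ k) \<rho> = distr \<rho> B (T ^^ k)"
          by (rule push_forward_funpow[OF T that])
        show "distr \<rho> B (T ^^ k) \<in> P"
          using that measurable_funpow[OF T]
          by (intro distr_in_P) (auto simp: borel_prob_measures_iff cong: measurable_cong_sets)
      qed
      have "W ((push_forward X d T ^^ k) \<rho>) ((push_forward X d T ^^ k) \<rho>')
          \<le> 2 * (\<Sum>c\<in>F. D k c) + 2 * C * \<eta>" if "\<rho> \<in> ?A" "\<rho>' \<in> ?A" for \<rho> \<rho>'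
      proof -
        have P: "\<rho> \<in> P" "\<rho>' \<in> P"
          using that by auto
        show ?thesis
          using W.triangle[OF P_k(2)[OF P(1)] P_k(2)[OF \<nu>] P_k(2)[OF P(2)]]
            near[OF that(1), of k] near[OF that(2), of k] P_k(1)[OF P(1)] P_k(1)[OF P(2)]
            W.commute[of "distr \<rho> B (T ^^ k)" "distr \<nu> B (T ^^ k)"]
          by simp
      qed
      then show ?thesis
        using False unfolding diam_def by (auto intro!: cSUP_least)
    qed
    have "\<forall>\<^sub>F n in sequentially. \<forall>c\<in>F. ereal (1 / real n * (\<Sum>k<n. D k c)) < ereal e"
      using F(1) \<delta>(2) unfolding mean_diam_def D_def
      by (intro eventually_ball_finite ballI Limsup_lessD)
    then have "\<forall>\<^sub>F n in sequentially. ereal (1 / real n * (\<Sum>k<n. diam W ((push_forward X d T ^^ k) ` ?A)))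
        \<le> ereal (2 * (real (card F) * e) + 2 * C * \<eta>)"
      using eventually_gt_at_top[of 0]
    proof eventually_elim
      case (elim n)
      have "(\<Sum>k<n. diam W ((push_forward X d T ^^ k) ` ?A))
          \<le> (\<Sum>k<n. 2 * (\<Sum>c\<in>F. D k c) + 2 * C * \<eta>)"
        by (intro sum_mono diam_le)
      also have "\<dots> = 2 * (\<Sum>c\<in>F. \<Sum>k<n. D k c) + real n * (2 * C * \<eta>)"
        unfolding sum.distrib sum_distrib_left[symmetric] by (subst sum.swap) simp
      finally have "1 / real n * (\<Sum>k<n. diam W ((push_forward X d T ^^ k) ` ?A))
          \<le> 1 / real n * (2 * (\<Sum>c\<in>F. \<Sum>k<n. D k c) + real n * (2 * C * \<eta>))"
        by (intro mult_left_mono) auto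
      also have "\<dots> = 2 * (\<Sum>c\<in>F. 1 / real n * (\<Sum>k<n. D k c)) + 2 * C * \<eta>"
      proof -
        have "1 / real n * (2 * S + real n * (2 * C * \<eta>)) = 2 * (1 / real n * S) + 2 * C * \<eta>" for S
          using elim(2) by (simp add: field_simps)
        then show ?thesis
          unfolding sum_distrib_left[symmetric] .
      qed
      finally have "1 / real n * (\<Sum>k<n. diam W ((push_forward X d T ^^ k) ` ?A))
          \<le> 2 * (\<Sum>c\<in>F. 1 / real n * (\<Sum>k<n. D k c)) + 2 * C * \<eta>" .
      moreover have "(\<Sum>c\<in>F. 1 / real n * (\<Sum>k<n. D k c)) \<le> (\<Sum>c\<in>F. e)"
        using elim(1) by (intro sum_mono) (auto intro: less_imp_le)
      ultimately show ?case
        by simp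
    qed
    then have "mean_diam W (push_forward X d T) ?A \<le> ereal (2 * (real (card F) * e) + 2 * C * \<eta>)"
      unfolding mean_diam_def by (rule Limsup_bounded)
    also have "2 * (real (card F) * e) + 2 * C * \<eta> < \<epsilon>"
    proof -
      have "2 * (real (card F) * e) < \<epsilon> / 2" "2 * C * \<eta> < \<epsilon> / 2"
        using \<open>0 < \<epsilon>\<close> C(1) by (auto simp: e_def \<eta>_def field_simps add_pos_nonneg)
      then show ?thesis
        by simp
    qed
    finally show ?thesis
      using m(1) pos(2) by (intro exI[of _ "m * \<eta> / 2"]) simp
  qed
  then show ?thesis
    using \<nu> by (simp add: diam_mean_equicontinuity_point_def)
qed

end

section \<open>Almost diam-mean equicontinuity passes to measures\<close>

theorem corollary5p1:
  fixes X :: "'a set" and d :: "'a \<Rightarrow> 'a \<Rightarrow> real" and T :: "'a \<Rightarrow> 'a"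
  assumes "dynamical_system X d T"
    and "almost_diam_mean_equicontinuous X d T"
  shows "almost_diam_mean_equicontinuous
           (borel_prob_measures X d) (wasserstein X d) (push_forward X d T)"
proof -
  interpret Metric_space X d
    using assms(1) by (simp add: dynamical_system_def)
  interpret compact_metric_space X d
    using assms(1) by unfold_locales (simp add: dynamical_system_def)
  interpret W: Metric_space P W
    by (rule wasserstein_metric)
  have T: "T \<in> measurable B B"
    using assms(1) by (intro measurable_continuous_map) (simp add: dynamical_system_def)
  define E where "E = {x. diam_mean_equicontinuity_point X d T x}"
  have dense: "X \<subseteq> mtopology closure_of E"
    using assms(2) by (simp add: almost_diam_mean_equicontinuous_def E_def)
  have "\<exists>\<nu>. diam_mean_equicontinuity_point P W (push_forward X d T) \<nu> \<and> \<nu> \<in> P \<and> W \<mu> \<nu> \<le> r"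
    if \<mu>: "\<mu> \<in> P" and "0 < r" for \<mu> r
  proof -
    obtain F \<nu> where F: "finite F" "F \<subseteq> E"
      and \<nu>: "\<nu> \<in> P" "AE x in \<nu>. x \<in> F" and "W \<mu> \<nu> \<le> r"
      using finitely_supported_approximation[OF dense \<mu> \<open>0 < r\<close>] .
    moreover have "diam_mean_equicontinuity_point P W (push_forward X d T) \<nu>"
      using F by (intro finitely_supported_equicontinuity_point[OF T \<nu>(1) F(1) _ \<nu>(2)]) (auto simp: E_def)
    ultimately show ?thesis
      by blast
  qed
  then show ?thesis
    unfolding almost_diam_mean_equicontinuous_def W.metric_closure_of_alt by fastforce
qed

end
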